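(* Assume that the transition density is bounded from below and above: $0<\sigma_-\le m(x,x')\le\sigma_+<\infty$ for all $(x,x')\in\mathbb X\times\mathbb X$. Let $C(N,T)$ denote the number of elementary operations required in the fast FFBSi smoothing algorithm (described in the context) with $N$ particles and time horizon $T$. Then there exists a constant $K$ such that $$\mathbb E[C(N,T)]\le K\,N\,T\,\frac{\sigma_+}{\sigma_-} .$$
   Context: Model and forward pass. $\mathbb X$ is a Polish space; $m$ is the transition density, with respect to a $\sigma$-finite measure $\nu$ on $\mathbb X$, of the Markov kernel of the hidden chain of a state space model. A forward auxiliary particle filter (any choice of adjustment weights and proposal kernels) has already produced particles $\xi_t^1,\dots,\xi_t^N\in\mathbb X$ with nonnegative weights $\omega_t^1,\dots,\omega_t^N$, $0\le t\le T$; these are the input. Fast FFBSi smoothing algorithm (backward pass producing index paths $J_{0:T}^\ell$, $1\le\ell\le N$): 1. Sample $J_T^1,\dots,J_T^N$ multinomially (i.i.d.) with probabilities proportional to $(\omega_T^i)_{i=1}^N$. 2. For $s$ from $T-1$ down to $0$: set the list $L\leftarrow(1,\dots,N)$. While $L$ is not empty: let $n$ be the size of $L$; sample $I_1,\dots,I_n$ multinomially (i.i.d.) with probabilities proportional to $(\omega_s^i)_{i=1}^N$ and $U_1,\dots,U_n$ i.i.d. uniform on $[0,1]$; for $k=1,\dots,n$, if $U_k\le m(\xi_s^{I_k},\xi_{s+1}^{J_{s+1}^{L(k)}})/\sigma_+$ set $J_s^{L(k)}\leftarrow I_k$, otherwise keep $L(k)$ for the next round; replace $L$ by the list of kept elements.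 Cost model. Drawing one uniform variable, evaluating $m$ and $\omega$, comparisons, arithmetic and assignments are elementary operations. The cumulative sums of the weights are formed once per time step (cost $O(N)$), and each multinomial sample of size $n\in\{1,\dots,N\}$ from a distribution on $N$ elements is produced by a procedure requiring $O\big(n(1+\log(1+N/n))\big)$ elementary operations. *)

theory Defs
  imports "HOL-Probability.Probability"
begin

text \<open>
  Particle indices are \<open>0, \<dots>, N - 1\<close>, and slots of lists also count from \<open>0\<close>.
\<close>

section \<open>Input\<close>

definition transition_density :: "'a::polish_space measure \<Rightarrow> ('a \<Rightarrow> 'a \<Rightarrow> real) \<Rightarrow> bool" where
  "transition_density \<nu> m \<longleftrightarrow>
     sigma_finite_measure \<nu> \<and> sets \<nu> = sets borel \<and>
     case_prod m \<in> borel_measurable (borel \<Otimes>\<^sub>M borel) \<and>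
     (\<forall>x y. 0 \<le> m x y) \<and> (\<forall>x. (\<integral>\<^sup>+ y. ennreal (m x y) \<partial>\<nu>) = 1)"

text \<open>
  The output of a forward filter: random particles \<open>\<xi> t i\<close> and weights \<open>w t i\<close> on some
  probability space, with arbitrary joint law. The weights at each time have a positive sum almost
  surely, as is needed for sampling with probabilities proportional to them.
\<close>

definition particle_system ::
    "nat \<Rightarrow> nat \<Rightarrow> 'w measure \<Rightarrow> (nat \<Rightarrow> nat \<Rightarrow> 'w \<Rightarrow> 'a::polish_space) \<Rightarrow> (nat \<Rightarrow> nat \<Rightarrow> 'w \<Rightarrow> real) \<Rightarrow> bool"
  where
  "particle_system N T P \<xi> w \<longleftrightarrow>
     prob_space P \<and>
     (\<forall>t\<le>T. \<forall>i<N. \<xi> t i \<in> borel_measurable P \<and> w t i \<in> borel_measurable P) \<and>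
     (\<forall>t\<le>T. \<forall>i<N. \<forall>x\<in>space P. 0 \<le> w t i x) \<and>
     (\<forall>t\<le>T. AE x in P. 0 < (\<Sum>i<N. w t i x))"


section \<open>Random draws of the backward pass\<close>

definition categorical :: "nat \<Rightarrow> (nat \<Rightarrow> real) \<Rightarrow> nat measure" where
  "categorical N v = point_measure {..<N} (\<lambda>i. ennreal (v i / (\<Sum>j<N. v j)))"

type_synonym draws = "(nat \<Rightarrow> nat) \<times> (nat \<times> nat \<times> nat \<Rightarrow> nat \<times> real)"

text \<open>
  The law, for given weights \<open>v\<close>, of all random draws. The first component contains the final
  indices; the second one contains, at \<open>(s, r, k)\<close>, the pair \<open>(I\<^sub>k, U\<^sub>k)\<close> for time \<open>s\<close> and the
  \<open>r\<close>-th round of the while loop. All coordinates are independent. Although \<open>N\<close> pairs are available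
  in every round, a round that starts with a list of size \<open>n\<close> reads (and is charged for) only the
  first \<open>n\<close> of them.
\<close>

definition draws_measure :: "nat \<Rightarrow> nat \<Rightarrow> (nat \<Rightarrow> nat \<Rightarrow> real) \<Rightarrow> draws measure" where
  "draws_measure N T v =
     (\<Pi>\<^sub>M l\<in>{..<N}. categorical N (v T)) \<Otimes>\<^sub>M
     (\<Pi>\<^sub>M q\<in>{..<T} \<times> UNIV \<times> {..<N}.
        categorical N (v (fst q)) \<Otimes>\<^sub>M uniform_measure lborel {0..1::real})"


section \<open>The backward pass\<close>

text \<open>
  One round at a fixed time \<open>s\<close>. Here \<open>x\<close> and \<open>x'\<close> are the particles at times \<open>s\<close> and \<open>s + 1\<close>,
  \<open>J'\<close> are the indices already chosen at time \<open>s + 1\<close>, \<open>d\<close> are the draws of the round, and the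
  state consists of the partially assigned indices at time \<open>s\<close> and the current list.
\<close>

fun ffbsi_round ::
    "('a \<Rightarrow> 'a \<Rightarrow> real) \<Rightarrow> real \<Rightarrow> (nat \<Rightarrow> 'a) \<Rightarrow> (nat \<Rightarrow> 'a) \<Rightarrow> (nat \<Rightarrow> nat) \<Rightarrow> (nat \<Rightarrow> nat \<times> real) \<Rightarrow>
     (nat \<Rightarrow> nat) \<times> nat list \<Rightarrow> (nat \<Rightarrow> nat) \<times> nat list" where
  "ffbsi_round m \<sigma> x x' J' d (J, L) =
     fold (\<lambda>k (J, kept).
             if snd (d k) \<le> m (x (fst (d k))) (x' (J' (L ! k))) / \<sigma>
             then (J(L ! k := fst (d k)), kept)
             else (J, kept @ [L ! k]))
          [0..<length L] (J, [])"

text \<open>State before the \<open>r\<close>-th round. Rounds on the empty list do not change the state.\<close>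

primrec ffbsi_state ::
    "('a \<Rightarrow> 'a \<Rightarrow> real) \<Rightarrow> real \<Rightarrow> nat \<Rightarrow> (nat \<Rightarrow> 'a) \<Rightarrow> (nat \<Rightarrow> 'a) \<Rightarrow> (nat \<Rightarrow> nat) \<Rightarrow>
     (nat \<Rightarrow> nat \<Rightarrow> nat \<times> real) \<Rightarrow> nat \<Rightarrow> (nat \<Rightarrow> nat) \<times> nat list" where
  "ffbsi_state m \<sigma> N x x' J' d 0 = ((\<lambda>_. 0), [0..<N])"
| "ffbsi_state m \<sigma> N x x' J' d (Suc r) =
     ffbsi_round m \<sigma> x x' J' (d r) (ffbsi_state m \<sigma> N x x' J' d r)"

text \<open>The indices on exit of the while loop, with a dummy value if it does not terminate.\<close>

definition ffbsi_indices ::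
    "('a \<Rightarrow> 'a \<Rightarrow> real) \<Rightarrow> real \<Rightarrow> nat \<Rightarrow> (nat \<Rightarrow> 'a) \<Rightarrow> (nat \<Rightarrow> 'a) \<Rightarrow> (nat \<Rightarrow> nat) \<Rightarrow>
     (nat \<Rightarrow> nat \<Rightarrow> nat \<times> real) \<Rightarrow> nat \<Rightarrow> nat" where
  "ffbsi_indices m \<sigma> N x x' J' d =
     (if \<exists>r. snd (ffbsi_state m \<sigma> N x x' J' d r) = []
      then fst (ffbsi_state m \<sigma> N x x' J' d
                  (LEAST r. snd (ffbsi_state m \<sigma> N x x' J' d r) = []))
      else (\<lambda>_. 0))"

text \<open>\<open>ffbsi_back \<dots> j\<close> contains the indices at time \<open>T - j\<close>.\<close>

primrec ffbsi_back ::
    "('a \<Rightarrow> 'a \<Rightarrow> real) \<Rightarrow> real \<Rightarrow> nat \<Rightarrow> nat \<Rightarrow> (nat \<Rightarrow> nat \<Rightarrow> 'a) \<Rightarrow> draws \<Rightarrow> nat \<Rightarrow> nat \<Rightarrow> nat" where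
  "ffbsi_back m \<sigma> N T x D 0 = fst D"
| "ffbsi_back m \<sigma> N T x D (Suc j) =
     ffbsi_indices m \<sigma> N (x (T - Suc j)) (x (T - j)) (ffbsi_back m \<sigma> N T x D j)
       (\<lambda>r k. snd D (T - Suc j, r, k))"

definition ffbsi_path ::
    "('a \<Rightarrow> 'a \<Rightarrow> real) \<Rightarrow> real \<Rightarrow> nat \<Rightarrow> nat \<Rightarrow> (nat \<Rightarrow> nat \<Rightarrow> 'a) \<Rightarrow> draws \<Rightarrow> nat \<Rightarrow> nat \<Rightarrow> nat" where
  "ffbsi_path m \<sigma> N T x D s = ffbsi_back m \<sigma> N T x D (T - s)"

definition ffbsi_list_size ::
    "('a \<Rightarrow> 'a \<Rightarrow> real) \<Rightarrow> real \<Rightarrow> nat \<Rightarrow> nat \<Rightarrow> (nat \<Rightarrow> nat \<Rightarrow> 'a) \<Rightarrow> draws \<Rightarrow> nat \<Rightarrow> nat \<Rightarrow> nat" where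
  "ffbsi_list_size m \<sigma> N T x D s r =
     length (snd (ffbsi_state m \<sigma> N (x s) (x (Suc s)) (ffbsi_path m \<sigma> N T x D (Suc s))
                    (\<lambda>r k. snd D (s, r, k)) r))"


section \<open>Cost\<close>

text \<open>
  \<open>cumsum_ops N\<close>: forming the cumulative sums of \<open>N\<close> weights.
  \<open>multinomial_ops N n\<close>: a multinomial sample of size \<open>n\<close> from \<open>N\<close> elements.
  \<open>entry_ops\<close>: filling one entry of \<open>J\<^sub>T\<close> or of the initial list \<open>L\<close>.
  \<open>test_ops\<close>: testing whether \<open>L\<close> is empty, reading its size and replacing it.
  \<open>candidate_ops\<close>: treating one candidate, that is, drawing \<open>U\<^sub>k\<close>, evaluating \<open>m\<close>, dividing,
  comparing, and either assigning the index or keeping the list element.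
\<close>

record cost_model =
  cumsum_ops :: "nat \<Rightarrow> nat"
  multinomial_ops :: "nat \<Rightarrow> nat \<Rightarrow> nat"
  entry_ops :: nat
  test_ops :: nat
  candidate_ops :: nat

definition admissible_cost_model :: "cost_model \<Rightarrow> bool" where
  "admissible_cost_model cm \<longleftrightarrow>
     (\<exists>c::real. \<forall>N\<ge>1. real (cumsum_ops cm N) \<le> c * real N) \<and>
     (\<exists>c::real. \<forall>N n. 1 \<le> n \<and> n \<le> N \<longrightarrow>
        real (multinomial_ops cm N n) \<le> c * (real n * (1 + ln (1 + real N / real n))))"

definition round_ops :: "cost_model \<Rightarrow> nat \<Rightarrow> nat \<Rightarrow> nat" where
  "round_ops cm N n =
     (if n = 0 then 0 else test_ops cm + multinomial_ops cm N n + n * candidate_ops cm)"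

text \<open>
  The number \<open>C(N, T)\<close> of operations; it is infinite if some while loop does not terminate and
  its rounds have positive cost. The separate summand \<open>test_ops\<close> is for the last test, on the
  empty list.
\<close>

definition ffbsi_cost ::
    "cost_model \<Rightarrow> ('a \<Rightarrow> 'a \<Rightarrow> real) \<Rightarrow> real \<Rightarrow> nat \<Rightarrow> nat \<Rightarrow> (nat \<Rightarrow> nat \<Rightarrow> 'a) \<Rightarrow> draws \<Rightarrow> ennreal" where
  "ffbsi_cost cm m \<sigma> N T x D =
     of_nat (cumsum_ops cm N + multinomial_ops cm N N + N * entry_ops cm) +
     (\<Sum>s<T. of_nat (cumsum_ops cm N + N * entry_ops cm + test_ops cm) +
             (\<Sum>r. of_nat (round_ops cm N (ffbsi_list_size m \<sigma> N T x D s r))))"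

text \<open>
  The outer integral is over the forward pass, the inner one over the draws of the backward pass
  given its outcome.
\<close>

definition expected_ffbsi_cost ::
    "cost_model \<Rightarrow> ('a \<Rightarrow> 'a \<Rightarrow> real) \<Rightarrow> real \<Rightarrow> nat \<Rightarrow> nat \<Rightarrow>
     'w measure \<Rightarrow> (nat \<Rightarrow> nat \<Rightarrow> 'w \<Rightarrow> 'a) \<Rightarrow> (nat \<Rightarrow> nat \<Rightarrow> 'w \<Rightarrow> real) \<Rightarrow> ennreal" where
  "expected_ffbsi_cost cm m \<sigma> N T P \<xi> w =
     (\<integral>\<^sup>+ z. (\<integral>\<^sup>+ D. ffbsi_cost cm m \<sigma> N T (\<lambda>t i. \<xi> t i z) D
                \<partial>draws_measure N T (\<lambda>t i. w t i z)) \<partial>P)"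

end

theory Submission
  imports Defs
begin

text \<open>A candidate is accepted with probability at least \<open>p = \<sigma>\<^sub>-/\<sigma>\<^sub>+\<close> whatever the past is, so the expected
  list size before round \<open>r\<close> is at most \<open>N (1 - p)\<^sup>r \<le> N exp (- p r)\<close>. Bounding the concave function
  \<open>n (1 + ln (1 + N/n))\<close> by an affine function of \<open>n\<close> adapted to \<open>r\<close>, the expected cost of round \<open>r\<close>
  is \<open>O(N exp (- p r/2))\<close>, and the sum over \<open>r\<close> is \<open>O(N/p)\<close>. The list sizes are compared pathwise with
  a process that depends on the uniform variables only, so no measurability of the algorithm itself
  is needed.\<close>

section \<open>Independence of coordinates\<close>

text \<open>Fubini after splitting off coordinate \<open>i\<close>: since \<open>g\<close> ignores
  that coordinate, the iterated integral factors. Independence is expressed pointwise by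
  \<open>indep\<close>, and \<open>I\<close> may be infinite, as it must be for an unbounded number
  of rounds.\<close>

lemma nn_integral_PiM_mult_coordinate:
  fixes g :: "('i \<Rightarrow> 'b) \<Rightarrow> ennreal" and h :: "'b \<Rightarrow> ennreal"
  assumes M: "\<And>j. j \<in> I \<Longrightarrow> prob_space (M j)" and i: "i \<in> I"
    and g[measurable]: "g \<in> borel_measurable (PiM I M)"
    and h[measurable]: "h \<in> borel_measurable (M i)"
    and indep: "\<And>X x. g (X(i := x)) = g X"
  shows "(\<integral>\<^sup>+\<omega>. g \<omega> * h (\<omega> i) \<partial>PiM I M) = (\<integral>\<^sup>+\<omega>. g \<omega> \<partial>PiM I M) * (\<integral>\<^sup>+x. h x \<partial>M i)"
proof -
  define I' where "I' = I - {i}"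
  have I: "insert i I' = I" using i by (auto simp: I'_def)
  interpret Mi: prob_space "M i" using M i by blast
  interpret R: prob_space "PiM I' M" by (rule prob_space_PiM) (use M in \<open>auto simp: I'_def\<close>)
  have upd[measurable]: "(\<lambda>(x, X). X(i := x)) \<in> M i \<Otimes>\<^sub>M PiM I' M \<rightarrow>\<^sub>M PiM I M"
  proof -
    have "(\<lambda>(x, X). X(i := x)) \<in> M i \<Otimes>\<^sub>M PiM I' M \<rightarrow>\<^sub>M PiM (insert i I') M" by measurable
    then show ?thesis by (simp only: I)
  qed
  have split: "PiM I M = distr (M i \<Otimes>\<^sub>M PiM I' M) (PiM I M) (\<lambda>(x, X). X(i := x))"
    using distr_pair_PiM_eq_PiM[of I' M i] M i unfolding I by (simp add: I'_def)
  have coord[measurable]: "(\<lambda>\<omega>. \<omega> i) \<in> PiM I M \<rightarrow>\<^sub>M M i"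
    using i by (rule measurable_component_singleton)
  have hc[measurable]: "(\<lambda>\<omega>. h (\<omega> i)) \<in> borel_measurable (PiM I M)"
    by (rule measurable_compose[OF coord h])
  have disint: "(\<integral>\<^sup>+\<omega>. f \<omega> \<partial>PiM I M) = (\<integral>\<^sup>+x. \<integral>\<^sup>+X. f (X(i := x)) \<partial>PiM I' M \<partial>M i)"
    if f[measurable]: "f \<in> borel_measurable (PiM I M)" for f :: "('i \<Rightarrow> 'b) \<Rightarrow> ennreal"
  proof -
    have "(\<integral>\<^sup>+\<omega>. f \<omega> \<partial>PiM I M) = (\<integral>\<^sup>+z. f ((\<lambda>(x, X). X(i := x)) z) \<partial>(M i \<Otimes>\<^sub>M PiM I' M))"
      by (subst split, rule nn_integral_distr) measurable
    also have "\<dots> = (\<integral>\<^sup>+x. \<integral>\<^sup>+X. f (X(i := x)) \<partial>PiM I' M \<partial>M i)"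
      by (subst R.nn_integral_fst[symmetric]) (auto intro: measurable_compose[OF upd f])
    finally show ?thesis .
  qed
  have gx: "g \<in> borel_measurable (PiM I' M)"
  proof -
    \<comment> \<open>The section of \<open>g\<close> at one fixed value of coordinate
      \<open>i\<close> is measurable in the other coordinates, and by \<open>indep\<close> this
      section is \<open>g\<close> itself.\<close>
    obtain x where "x \<in> space (M i)" using Mi.not_empty by blast
    then have "(\<lambda>X. (x, X)) \<in> PiM I' M \<rightarrow>\<^sub>M M i \<Otimes>\<^sub>M PiM I' M" by measurable
    from measurable_compose[OF measurable_compose[OF this upd] g]
    show ?thesis by (simp add: indep)
  qed
  have "(\<integral>\<^sup>+\<omega>. g \<omega> * h (\<omega> i) \<partial>PiM I M) = (\<integral>\<^sup>+x. \<integral>\<^sup>+X. g X * h x \<partial>PiM I' M \<partial>M i)"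
    by (subst disint) (auto simp: indep)
  also have "\<dots> = (\<integral>\<^sup>+X. g X \<partial>PiM I' M) * (\<integral>\<^sup>+x. h x \<partial>M i)"
    by (simp add: nn_integral_multc[OF gx] nn_integral_cmult)
  \<comment> \<open>The inner integral does not depend on \<open>x\<close>, and \<open>M i\<close>
    has total mass 1.\<close>
  also have "(\<integral>\<^sup>+X. g X \<partial>PiM I' M) = (\<integral>\<^sup>+\<omega>. g \<omega> \<partial>PiM I M)"
    by (subst disint) (auto simp: indep Mi.emeasure_space_1)
  finally show ?thesis .
qed

section \<open>Marginals and the laws of single draws\<close>

lemma nn_integral_pair_snd:
  assumes "prob_space A" "sigma_finite_measure B" "f \<in> borel_measurable B"
  shows "(\<integral>\<^sup>+z. f (snd z) \<partial>(A \<Otimes>\<^sub>M B)) = (\<integral>\<^sup>+y. f y \<partial>B)"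
proof -
  interpret A: prob_space A by fact
  interpret B: sigma_finite_measure B by fact
  show ?thesis
    by (subst B.nn_integral_fst[symmetric])
      (use assms(3) in \<open>auto simp: A.emeasure_space_1\<close>)
qed

lemma prob_space_uniform_unit: "prob_space (uniform_measure lborel {0..1::real})"
  by (rule prob_space_uniform_measure) auto

lemma prob_space_categorical:
  assumes "\<And>i. i < N \<Longrightarrow> 0 \<le> v i" "0 < (\<Sum>i<N. v i)"
  shows "prob_space (categorical N v)"
  unfolding categorical_def
proof (rule prob_space_point_measure)
  show "(\<Sum>i<N. ennreal (v i / (\<Sum>j<N. v j))) = 1"
    using assms by (subst sum_ennreal) (auto simp flip: sum_divide_distrib)
qed auto

section \<open>The dominating process\<close>

text \<open>A candidate whose uniform variable is at most \<open>\<sigma>\<^sub>-/\<sigma>\<^sub>+\<close> is accepted whatever the particles are,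
  so the list sizes are dominated by the following process, in which no other candidate is accepted.\<close>

primrec survivors :: "real \<Rightarrow> nat \<Rightarrow> (nat \<Rightarrow> nat \<Rightarrow> 'i \<times> real) \<Rightarrow> nat \<Rightarrow> nat" where
  "survivors p N d 0 = N"
| "survivors p N d (Suc r) = card {k. k < survivors p N d r \<and> p < snd (d r k)}"

lemma survivors_le: "survivors p N d r \<le> N"
proof (induction r)
  case (Suc r)
  have "card {k. k < survivors p N d r \<and> p < snd (d r k)} \<le> card {..<survivors p N d r}"
    by (rule card_mono) auto
  with Suc show ?case by simp
qed simp

text \<open>The size before round \<open>r\<close> depends on earlier rounds only; this is what
  makes it independent of the draws of round \<open>r\<close>.\<close>

lemma survivors_cong:
  assumes "\<And>r' k. r' < r \<Longrightarrow> d r' k = d' r' k"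
  shows "survivors p N d r = survivors p N d' r"
  using assms by (induction r) auto

text \<open>Replaces a random range of slots by the fixed range \<open>{..<N}\<close>, so that
  measurability and expectation can be treated one summand at a time, each summand being a product
  of a past and a present factor.\<close>

lemma survivors_Suc_eq_sum:
  "survivors p N d (Suc r) =
    (\<Sum>k<N. of_bool (k < survivors p N d r) * of_bool (p < snd (d r k)))"
proof -
  have "{k. k < survivors p N d r \<and> p < snd (d r k)} =
      {..<N} \<inter> {k. k < survivors p N d r \<and> p < snd (d r k)}"
    using survivors_le[of p N d r] by auto
  then show ?thesis
    by (simp del: sum_mult_of_bool_eq sum_of_bool_mult_eq flip: of_bool_conj)
qed

section \<open>Pathwise comparison of the algorithm with the dominating process\<close>

lemma length_ffbsi_round_le:
  assumes "0 < \<sigma>" and "\<And>x x'. \<sigma>\<^sub>m \<le> m x x'"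
  shows "length (snd (ffbsi_round m \<sigma> x x' J' d (J, L))) \<le>
    card {k. k < length L \<and> \<sigma>\<^sub>m / \<sigma> < snd (d k)}"
proof -
  define f where "f = (\<lambda>k (J, kept).
             if snd (d k) \<le> m (x (fst (d k))) (x' (J' (L ! k))) / \<sigma>
             then (J(L ! k := fst (d k)), kept)
             else (J, kept @ [L ! k]))"
  have step: "length (snd (f k s)) \<le> length (snd s) + (if \<sigma>\<^sub>m / \<sigma> < snd (d k) then 1 else 0)" for k s
  proof -
    \<comment> \<open>The ratio lies below every acceptance threshold, so a candidate that is kept
      must have a uniform variable above it.\<close>
    have "\<sigma>\<^sub>m / \<sigma> \<le> m (x (fst (d k))) (x' (J' (L ! k))) / \<sigma>"
      using assms by (simp add: divide_right_mono)
    then show ?thesis by (auto simp: f_def split: prod.splits)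
  qed
  have "length (snd (fold f ks s)) \<le> length (snd s) + length (filter (\<lambda>k. \<sigma>\<^sub>m / \<sigma> < snd (d k)) ks)"
    for ks s
  proof (induction ks arbitrary: s)
    case (Cons k ks)
    show ?case using Cons[of "f k s"] step[of k s] by (auto split: if_splits)
  qed simp
  from this[of "[0..<length L]" "(J, [])"]
  show ?thesis by (simp add: f_def length_filter_conv_card cong: conj_cong)
qed

text \<open>Draws are read by position in the list, not by particle. Both processes therefore read
  initial segments of the same draws, and the longer segment contains at least as many variables
  above the threshold.\<close>

lemma length_ffbsi_state_le_survivors:
  assumes "0 < \<sigma>" and "\<And>x x'. \<sigma>\<^sub>m \<le> m x x'"
  shows "length (snd (ffbsi_state m \<sigma> N x x' J' d r)) \<le> survivors (\<sigma>\<^sub>m / \<sigma>) N d r"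
proof (induction r)
  case (Suc r)
  obtain J L where JL: "ffbsi_state m \<sigma> N x x' J' d r = (J, L)" by fastforce
  have "length (snd (ffbsi_state m \<sigma> N x x' J' d (Suc r))) \<le>
      card {k. k < length L \<and> \<sigma>\<^sub>m / \<sigma> < snd (d r k)}"
    using length_ffbsi_round_le[OF assms] by (simp add: JL del: ffbsi_round.simps)
  also have "\<dots> \<le> survivors (\<sigma>\<^sub>m / \<sigma>) N d (Suc r)"
    using Suc by (auto simp: JL intro!: card_mono)
  finally show ?case .
qed simp

lemma ffbsi_list_size_le_survivors:
  assumes "0 < \<sigma>" and "\<And>x x'. \<sigma>\<^sub>m \<le> m x x'"
  shows "ffbsi_list_size m \<sigma> N T x D s r \<le> survivors (\<sigma>\<^sub>m / \<sigma>) N (\<lambda>r k. snd D (s, r, k)) r"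
  unfolding ffbsi_list_size_def by (rule length_ffbsi_state_le_survivors[OF assms])

section \<open>Geometric decay of the mean of the dominating process\<close>

context
  fixes p :: real and N T :: nat and C :: "nat \<times> nat \<times> nat \<Rightarrow> nat measure"
    and M :: "nat \<times> nat \<times> nat \<Rightarrow> (nat \<times> real) measure" and I
  defines "I \<equiv> {..<T} \<times> UNIV \<times> {..<N}"
    and "M \<equiv> \<lambda>q. C q \<Otimes>\<^sub>M uniform_measure lborel {0..1::real}"
  assumes p: "0 \<le> p" "p \<le> 1"
    and C: "\<And>q. q \<in> I \<Longrightarrow> prob_space (C q)"
begin

lemma measurable_survivors:
  assumes s: "s < T"
  shows "(\<lambda>\<omega>. survivors p N (\<lambda>r k. \<omega> (s, r, k)) r) \<in> PiM I M \<rightarrow>\<^sub>M count_space UNIV"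
proof (induction r)
  case (Suc r)
  note Suc[measurable]
  have [measurable]: "(\<lambda>\<omega>. snd (\<omega> (s, r, k))) \<in> borel_measurable (PiM I M)" if "k < N" for k
  proof -
    have "(\<lambda>\<omega>. \<omega> (s, r, k)) \<in> PiM I M \<rightarrow>\<^sub>M M (s, r, k)"
      using s that by (intro measurable_component_singleton) (auto simp: I_def)
    moreover have "snd \<in> borel_measurable (M (s, r, k))"
      by (simp add: M_def)
    ultimately show ?thesis by (rule measurable_compose)
  qed
  show ?case
    unfolding survivors_Suc_eq_sum of_bool_def by measurable
qed simp

text \<open>Each slot occupied before a round survives it with probability exactly
  \<open>1 - p\<close>, independently of the past, so the mean is multiplied by \<open>1 - p\<close>
  in every round.\<close>

lemma nn_integral_survivors:
  assumes s: "s < T"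
  shows "(\<integral>\<^sup>+\<omega>. of_nat (survivors p N (\<lambda>r k. \<omega> (s, r, k)) r) \<partial>PiM I M) = ennreal (real N * (1 - p) ^ r)"
proof (induction r)
  case 0
  have "prob_space (PiM I M)"
    unfolding M_def
    by (intro prob_space_PiM prob_space_pair C prob_space_uniform_unit)
  then show ?case by (simp add: prob_space.emeasure_space_1 ennreal_of_nat_eq_real_of_nat)
next
  case (Suc r)
  let ?B = "\<lambda>\<omega>. survivors p N (\<lambda>r k. \<omega> (s, r, k)) r"
  let ?g = "\<lambda>k \<omega>. of_bool (k < ?B \<omega>) :: ennreal"
  let ?h = "\<lambda>z :: nat \<times> real. of_bool (p < snd z) :: ennreal"
  note measurable_survivors[OF s, measurable]
  have M: "prob_space (M q)" if "q \<in> I" for q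
    unfolding M_def using that by (intro prob_space_pair C prob_space_uniform_unit)
  have g[measurable]: "?g k \<in> borel_measurable (PiM I M)" for k
    unfolding of_bool_def by measurable
  have h: "?h \<in> borel_measurable (M q)" for q
    unfolding of_bool_def M_def by measurable
  have int_h: "(\<integral>\<^sup>+z. ?h z \<partial>M q) = ennreal (1 - p)" if "q \<in> I" for q
  proof -
    interpret U: prob_space "uniform_measure lborel {0..1::real}" by (rule prob_space_uniform_unit)
    have "(\<integral>\<^sup>+z. ?h z \<partial>M q) =
        (\<integral>\<^sup>+u. indicator {p<..} u \<partial>uniform_measure lborel {0..1::real})"
      unfolding M_def
      by (subst nn_integral_pair_snd[OF C[OF that], symmetric])
        (auto intro!: nn_integral_cong U.sigma_finite_measure_axioms simp: indicator_def)
    also have "\<dots> = emeasure lborel ({0..1} \<inter> {p<..})"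
      by (subst nn_integral_indicator) (auto simp: divide_ennreal_def)
    also have "{0..1} \<inter> {p<..} = {p<..1}" using p by auto
    finally show ?thesis using p by simp
  qed
  have prod: "(\<integral>\<^sup>+\<omega>. ?g k \<omega> * ?h (\<omega> (s, r, k)) \<partial>PiM I M) = (\<integral>\<^sup>+\<omega>. ?g k \<omega> \<partial>PiM I M) * ennreal (1 - p)"
    if k: "k < N" for k
  proof -
    have i: "(s, r, k) \<in> I" using s k by (simp add: I_def)
    \<comment> \<open>The size before round \<open>r\<close> does not read the draw at
      \<open>(s, r, k)\<close>, so the two factors of the summand are independent.\<close>
    have upd: "?g k (X(i := x)) = ?g k X" if "i = (s, r, k)" for X x i
    proof -
      have "?B (X(i := x)) = ?B X" using that by (intro survivors_cong) auto
      then show ?thesis by simp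
    qed
    show ?thesis
      by (subst nn_integral_PiM_mult_coordinate[OF M i g h upd[OF refl]]) (simp_all add: int_h[OF i])
  qed
  have gh: "(\<lambda>\<omega>. ?g k \<omega> * ?h (\<omega> (s, r, k))) \<in> borel_measurable (PiM I M)" if "k < N" for k
  proof -
    have "(\<lambda>\<omega>. \<omega> (s, r, k)) \<in> PiM I M \<rightarrow>\<^sub>M M (s, r, k)"
      using s that by (intro measurable_component_singleton) (auto simp: I_def)
    from measurable_compose[OF this h] show ?thesis
      by (intro borel_measurable_times_ennreal g)
  qed
  have "(\<integral>\<^sup>+\<omega>. of_nat (survivors p N (\<lambda>r k. \<omega> (s, r, k)) (Suc r)) \<partial>PiM I M) =
      (\<integral>\<^sup>+\<omega>. (\<Sum>k<N. ?g k \<omega> * ?h (\<omega> (s, r, k))) \<partial>PiM I M)"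
    unfolding survivors_Suc_eq_sum by (simp del: of_bool_eq_iff)
  also have "\<dots> = (\<Sum>k<N. \<integral>\<^sup>+\<omega>. ?g k \<omega> * ?h (\<omega> (s, r, k)) \<partial>PiM I M)"
    by (rule nn_integral_sum) (use gh in auto)
  also have "\<dots> = (\<Sum>k<N. (\<integral>\<^sup>+\<omega>. ?g k \<omega> \<partial>PiM I M)) * ennreal (1 - p)"
    by (simp add: prod sum_distrib_right)
  also have "(\<Sum>k<N. (\<integral>\<^sup>+\<omega>. ?g k \<omega> \<partial>PiM I M)) = (\<integral>\<^sup>+\<omega>. (\<Sum>k<N. ?g k \<omega>) \<partial>PiM I M)"
    by (rule nn_integral_sum[symmetric]) (rule g)
  also have "\<dots> = (\<integral>\<^sup>+\<omega>. of_nat (?B \<omega>) \<partial>PiM I M)"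
  proof (rule nn_integral_cong)
    fix \<omega>
    have "{..<N} \<inter> {k. k < ?B \<omega>} = {..<?B \<omega>}"
      using survivors_le[of p N "\<lambda>r k. \<omega> (s, r, k)" r] by auto
    then show "(\<Sum>k<N. ?g k \<omega>) = of_nat (?B \<omega>)" by simp
  qed
  also have "\<dots> * ennreal (1 - p) = ennreal (real N * (1 - p) ^ Suc r)"
    using p unfolding Suc by (subst ennreal_mult[symmetric]) (auto simp: algebra_simps)
  finally show ?case .
qed

end

section \<open>The cost of the rounds\<close>

text \<open>The logarithm is replaced by its tangent at \<open>exp x\<close>, which makes the bound affine in \<open>n\<close>; the
  point \<open>x\<close> will be chosen according to the expected list size.\<close>

lemma multinomial_bound_affine:
  fixes x :: real
  assumes "0 \<le> x" "1 \<le> n"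
  shows "real n * (1 + ln (1 + real N / real n)) \<le> (1 + x) * real n + exp (- x) * real N"
proof -
  have "ln ((1 + real N / real n) * exp (- x)) \<le> (1 + real N / real n) * exp (- x) - 1"
    by (rule ln_le_minus_one) (auto intro!: mult_pos_pos add_pos_nonneg)
  also have "ln ((1 + real N / real n) * exp (- x)) = ln (1 + real N / real n) - x"
    by (subst ln_mult) (auto intro: add_pos_nonneg simp: add_pos_nonneg order.strict_implies_not_eq[symmetric])
  finally have "ln (1 + real N / real n) \<le> x + exp (- x) - 1 + real N / real n * exp (- x)"
    by (simp add: algebra_simps)
  \<comment> \<open>Drops \<open>exp (- x) - 1\<close>, which is nonpositive because
    \<open>0 \<le> x\<close>.\<close>
  also have "\<dots> \<le> x + real N / real n * exp (- x)"
    using assms by simp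
  finally have "real n * (1 + ln (1 + real N / real n)) \<le> real n * (1 + (x + real N / real n * exp (- x)))"
    by (intro mult_left_mono) auto
  also have "\<dots> = (1 + x) * real n + exp (- x) * real N"
    using assms by (simp add: field_simps)
  finally show ?thesis .
qed

lemma sums_exp:
  fixes x :: real
  assumes "0 < x"
  shows "(\<lambda>r. exp (- x * real r)) sums (1 / (1 - exp (- x)))"
proof -
  have "(\<lambda>r. exp (- x) ^ r) sums (1 / (1 - exp (- x)))"
    using assms by (intro geometric_sums) simp
  then show ?thesis
    by (simp add: mult.commute flip: exp_of_nat_mult)
qed

text \<open>Turns a geometric sum of rate \<open>x\<close> into a multiple of \<open>1 / x\<close>.
  The inequality \<open>1 / (1 + x) \<le> 1 - x / 2\<close> is where \<open>x \<le> 1\<close>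
  enters.\<close>

lemma sum_exp_le:
  fixes x :: real
  assumes "0 < x" "x \<le> 1"
  shows "1 / (1 - exp (- x)) \<le> 2 / x"
proof -
  have "exp (- x) \<le> 1 / (1 + x)"
    using exp_ge_add_one_self[of x] assms by (simp add: exp_minus field_simps)
  also have "\<dots> \<le> 1 - x / 2" using assms by (simp add: field_simps mult_le_one)
  finally have "x / 2 \<le> 1 - exp (- x)" by simp
  then have "1 / (1 - exp (- x)) \<le> 1 / (x / 2)"
    using assms by (intro divide_left_mono mult_pos_pos) auto
  then show ?thesis by simp
qed

text \<open>The cost of a multinomial sample is bounded but not assumed monotone in its size. The
  affine bound is therefore applied at the true size \<open>n\<close> first, and only then enlarged
  to the dominating size \<open>b\<close>.\<close>

lemma round_ops_le:
  assumes c: "0 \<le> c"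
    and mult: "\<And>n. 1 \<le> n \<Longrightarrow> n \<le> N \<Longrightarrow>
      real (multinomial_ops cm N n) \<le> c * (real n * (1 + ln (1 + real N / real n)))"
    and n: "n \<le> b" "b \<le> N" and x: "0 \<le> x"
  shows "real (round_ops cm N n) \<le>
    (real (test_ops cm) + c + real (candidate_ops cm)) * ((1 + x) * real b + exp (- x) * real N)"
    (is "_ \<le> (?t + c + ?d) * ?A")
proof (cases "n = 0")
  case True
  then show ?thesis using c x by (simp add: round_ops_def)
next
  case False
  let ?G = "real n * (1 + ln (1 + real N / real n))"
  have "?G \<le> (1 + x) * real n + exp (- x) * real N"
    using False x by (intro multinomial_bound_affine) auto
  also have "\<dots> \<le> ?A"
    using n x by (intro add_mono mult_left_mono) auto
  finally have GA: "?G \<le> ?A" .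
  \<comment> \<open>The logarithm is nonnegative, so the same affine quantity also absorbs the costs
    linear in \<open>n\<close> and, as \<open>1 \<le> n\<close>, the constant cost of the
    test.\<close>
  have nA: "real n \<le> ?A"
  proof -
    have "real n \<le> ?G" using False by (simp add: mult_le_cancel_left1)
    with GA show ?thesis by simp
  qed
  have "real (round_ops cm N n) = ?t + real (multinomial_ops cm N n) + real n * ?d"
    using False by (simp add: round_ops_def)
  also have "\<dots> \<le> ?t * real n + c * ?G + real n * ?d"
    using False n mult[of n] by (intro add_mono) (auto simp: mult_le_cancel_left1)
  also have "\<dots> \<le> ?t * ?A + c * ?A + ?A * ?d"
    using c GA nA by (intro add_mono mult_left_mono mult_right_mono) auto
  finally show ?thesis by (simp add: algebra_simps)
qed

text \<open>The bound conditional on the forward pass, with explicit constants so that they can be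
  seen not to depend on particles or weights. The factor 8 is 2, from two exponential terms per
  round, times 4, from summing a geometric series of rate \<open>p / 2\<close>.\<close>

lemma nn_integral_ffbsi_cost_le:
  fixes v :: "nat \<Rightarrow> nat \<Rightarrow> real" and m :: "'a \<Rightarrow> 'a \<Rightarrow> real"
  assumes v: "\<And>t i. t \<le> T \<Longrightarrow> i < N \<Longrightarrow> 0 \<le> v t i" "\<And>t. t \<le> T \<Longrightarrow> 0 < (\<Sum>i<N. v t i)"
    and m: "0 < \<sigma>\<^sub>m" "\<And>x x'. \<sigma>\<^sub>m \<le> m x x'" and \<sigma>: "\<sigma>\<^sub>m \<le> \<sigma>"
    and c: "0 \<le> c"
    and mult: "\<And>n. 1 \<le> n \<Longrightarrow> n \<le> N \<Longrightarrow>
      real (multinomial_ops cm N n) \<le> c * (real n * (1 + ln (1 + real N / real n)))"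
  shows "(\<integral>\<^sup>+D. ffbsi_cost cm m \<sigma> N T x D \<partial>draws_measure N T v) \<le>
    ennreal (real (cumsum_ops cm N + multinomial_ops cm N N + N * entry_ops cm) +
      real T * (real (cumsum_ops cm N + N * entry_ops cm + test_ops cm) +
        8 * (real (test_ops cm) + c + real (candidate_ops cm)) * real N * (\<sigma> / \<sigma>\<^sub>m)))"
    (is "_ \<le> ennreal (real ?A0 + real T * (real ?A1 + 8 * ?a * real N * _))")
proof -
  define a where "a = ?a"
  define p where "p = \<sigma>\<^sub>m / \<sigma>"
  have \<sigma>0: "0 < \<sigma>" using m \<sigma> by simp
  have p: "0 < p" "p \<le> 1" using m \<sigma> \<sigma>0 by (auto simp: p_def)
  \<comment> \<open>The tangent point for round \<open>r\<close> uses half of the decay rate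
    \<open>p\<close>: the other half compensates the factor \<open>1 + X r\<close>, and the constant
    term \<open>exp (- X r) * real N\<close> still decays geometrically.\<close>
  define X where "X = (\<lambda>r. p / 2 * real r)"
  define I where "I = {..<T} \<times> (UNIV :: nat set) \<times> {..<N}"
  define C where "C = (\<lambda>q :: nat \<times> nat \<times> nat. categorical N (v (fst q)))"
  define M where "M = (\<lambda>q. C q \<Otimes>\<^sub>M uniform_measure lborel {0..1::real})"
  define B where "B = (\<lambda>(s::nat) r \<omega>. survivors p N (\<lambda>r k. \<omega> (s, r, k) :: nat \<times> real) r)"
  define F where "F = (\<lambda>s r \<omega>. ennreal (a * (1 + X r)) * of_nat (B s r \<omega>) + ennreal (a * exp (- X r) * real N))"
  have a: "0 \<le> a" using c by (simp add: a_def)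
  have X: "0 \<le> X r" for r using p by (simp add: X_def)
  have C: "prob_space (C q)" if "q \<in> I" for q
    unfolding C_def using that v by (intro prob_space_categorical) (auto simp: I_def)
  have M: "prob_space (M q)" if "q \<in> I" for q
    unfolding M_def using that by (intro prob_space_pair C prob_space_uniform_unit)
  interpret PM: prob_space "PiM I M" using M by (rule prob_space_PiM)
  have B[measurable]: "B s r \<in> PiM I M \<rightarrow>\<^sub>M count_space UNIV" if "s < T" for s r
    unfolding B_def I_def M_def
    by (rule measurable_survivors) (use p C that in \<open>auto simp: I_def\<close>)
  have EB: "(\<integral>\<^sup>+\<omega>. of_nat (B s r \<omega>) \<partial>PiM I M) = ennreal (real N * (1 - p) ^ r)" if "s < T" for s r
    unfolding B_def I_def M_def
    by (rule nn_integral_survivors) (use p C that in \<open>auto simp: I_def\<close>)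
  have F[measurable]: "F s r \<in> borel_measurable (PiM I M)" if "s < T" for s r
    unfolding F_def using B[OF that, measurable] by measurable
  have EF: "(\<integral>\<^sup>+\<omega>. F s r \<omega> \<partial>PiM I M) \<le> ennreal (2 * a * real N * exp (- (p / 2) * real r))"
    if s: "s < T" for s r
  proof -
    note B[OF s, measurable]
    have "(\<integral>\<^sup>+\<omega>. F s r \<omega> \<partial>PiM I M) =
        ennreal (a * (1 + X r)) * ennreal (real N * (1 - p) ^ r) + ennreal (a * exp (- X r) * real N)"
      unfolding F_def
      by (simp add: nn_integral_add nn_integral_cmult EB[OF s] PM.emeasure_space_1)
    also have "\<dots> = ennreal (a * real N * ((1 + X r) * (1 - p) ^ r + exp (- X r)))"
      using p a X[of r]
      by (simp flip: ennreal_mult ennreal_plus) (simp add: algebra_simps)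
    also have "\<dots> \<le> ennreal (a * real N * (exp (- X r) + exp (- X r)))"
    proof (intro ennreal_leI mult_left_mono add_mono order_refl)
      \<comment> \<open>One of the two factors \<open>exp (- X r)\<close> contained in
        \<open>exp (- p) ^ r\<close> cancels \<open>1 + X r \<le> exp (X r)\<close>.\<close>
      have "(1 - p) ^ r \<le> exp (- p) ^ r"
        using p exp_ge_add_one_self[of "- p"] by (intro power_mono) auto
      also have "\<dots> = exp (- X r) * exp (- X r)"
        by (simp add: X_def field_simps flip: exp_of_nat_mult exp_add)
      finally have "(1 + X r) * (1 - p) ^ r \<le> exp (X r) * (exp (- X r) * exp (- X r))"
        using p X[of r] exp_ge_add_one_self[of "X r"] by (intro mult_mono) auto
      also have "\<dots> = exp (- X r)" by (simp flip: exp_add)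
      finally show "(1 + X r) * (1 - p) ^ r \<le> exp (- X r)" .
    qed (use a in auto)
    also have "\<dots> = ennreal (2 * a * real N * exp (- (p / 2) * real r))"
      by (simp add: X_def algebra_simps)
    finally show ?thesis .
  qed
  have ESF: "(\<integral>\<^sup>+\<omega>. (\<Sum>r. F s r \<omega>) \<partial>PiM I M) \<le> ennreal (8 * a * real N * (\<sigma> / \<sigma>\<^sub>m))"
    if s: "s < T" for s
  proof -
    have "(\<integral>\<^sup>+\<omega>. (\<Sum>r. F s r \<omega>) \<partial>PiM I M) = (\<Sum>r. \<integral>\<^sup>+\<omega>. F s r \<omega> \<partial>PiM I M)"
      using F[OF s] by (rule nn_integral_suminf)
    also have "\<dots> \<le> (\<Sum>r. ennreal (2 * a * real N * exp (- (p / 2) * real r)))"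
      using EF[OF s] by (intro suminf_le) auto
    also have "\<dots> = ennreal (2 * a * real N * (1 / (1 - exp (- (p / 2)))))"
      using p a by (intro suminf_ennreal_eq sums_mult sums_exp) auto
    also have "\<dots> \<le> ennreal (2 * a * real N * (2 / (p / 2)))"
      using p a by (intro ennreal_leI mult_left_mono sum_exp_le) auto
    also have "\<dots> = ennreal (8 * a * real N * (\<sigma> / \<sigma>\<^sub>m))"
      by (simp add: p_def ac_simps)
    finally show ?thesis .
  qed
  let ?R = "\<lambda>\<omega>. of_nat ?A0 + (\<Sum>s<T. of_nat ?A1 + (\<Sum>r. F s r \<omega>))"
  have R: "?R \<in> borel_measurable (PiM I M)"
    using F by (intro borel_measurable_add borel_measurable_sum) auto
  \<comment> \<open>Termwise in \<open>s\<close> and \<open>r\<close>, for every \<open>D\<close>,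
    including draws for which some loop does not terminate. The majorant ignores the final indices
    \<open>fst D\<close>.\<close>
  have cost: "ffbsi_cost cm m \<sigma> N T x D \<le> ?R (snd D)" for D
    unfolding ffbsi_cost_def
  proof (intro add_mono sum_mono order_refl suminf_le summableI)
    fix s r
    have "real (round_ops cm N (ffbsi_list_size m \<sigma> N T x D s r)) \<le>
        a * ((1 + X r) * real (B s r (snd D)) + exp (- X r) * real N)"
      unfolding B_def p_def a_def
      by (intro round_ops_le[OF c mult] ffbsi_list_size_le_survivors[OF \<sigma>0 m(2)] survivors_le X)
    then have "ennreal (real (round_ops cm N (ffbsi_list_size m \<sigma> N T x D s r))) \<le>
        ennreal (a * ((1 + X r) * real (B s r (snd D)) + exp (- X r) * real N))"
      by (rule ennreal_leI)
    also have "\<dots> = F s r (snd D)"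
      using a X[of r]
      by (simp add: F_def ennreal_of_nat_eq_real_of_nat algebra_simps flip: ennreal_mult ennreal_plus)
    finally show "of_nat (round_ops cm N (ffbsi_list_size m \<sigma> N T x D s r)) \<le> F s r (snd D)"
      by (simp add: ennreal_of_nat_eq_real_of_nat)
  qed
  have draws: "draws_measure N T v = (\<Pi>\<^sub>M l\<in>{..<N}. categorical N (v T)) \<Otimes>\<^sub>M PiM I M"
    by (simp add: draws_measure_def I_def M_def C_def)
  have "(\<integral>\<^sup>+D. ffbsi_cost cm m \<sigma> N T x D \<partial>draws_measure N T v) \<le> (\<integral>\<^sup>+D. ?R (snd D) \<partial>draws_measure N T v)"
    by (rule nn_integral_mono) (rule cost)
  also have "\<dots> = (\<integral>\<^sup>+\<omega>. ?R \<omega> \<partial>PiM I M)"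
    unfolding draws
    by (rule nn_integral_pair_snd[OF _ PM.sigma_finite_measure_axioms R])
      (use v in \<open>auto intro!: prob_space_PiM prob_space_categorical\<close>)
  also have "\<dots> = of_nat ?A0 + (\<Sum>s<T. of_nat ?A1 + (\<integral>\<^sup>+\<omega>. (\<Sum>r. F s r \<omega>) \<partial>PiM I M))"
  proof -
    have const: "(\<integral>\<^sup>+\<omega>. of_nat k + f \<omega> \<partial>PiM I M) = of_nat k + (\<integral>\<^sup>+\<omega>. f \<omega> \<partial>PiM I M)"
      if "f \<in> borel_measurable (PiM I M)" for k f
      using that by (simp add: nn_integral_add PM.emeasure_space_1)
    have SF: "(\<lambda>\<omega>. \<Sum>r. F s r \<omega>) \<in> borel_measurable (PiM I M)" if "s < T" for s
      using F[OF that] by measurable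
    have "(\<integral>\<^sup>+\<omega>. (\<Sum>s<T. of_nat ?A1 + (\<Sum>r. F s r \<omega>)) \<partial>PiM I M) =
        (\<Sum>s<T. \<integral>\<^sup>+\<omega>. of_nat ?A1 + (\<Sum>r. F s r \<omega>) \<partial>PiM I M)"
      by (rule nn_integral_sum) (use SF in auto)
    also have "\<dots> = (\<Sum>s<T. of_nat ?A1 + (\<integral>\<^sup>+\<omega>. (\<Sum>r. F s r \<omega>) \<partial>PiM I M))"
      using SF by (intro sum.cong refl const) auto
    finally show ?thesis
      by (subst const) (use SF in \<open>auto intro!: borel_measurable_sum\<close>)
  qed
  also have "\<dots> \<le> of_nat ?A0 + (\<Sum>s<T. of_nat ?A1 + ennreal (8 * a * real N * (\<sigma> / \<sigma>\<^sub>m)))"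
    using ESF by (intro add_mono sum_mono order_refl) auto
  also have "\<dots> = ennreal (real ?A0 + real T * (real ?A1 + 8 * a * real N * (\<sigma> / \<sigma>\<^sub>m)))"
    using a m \<sigma>0
    by (simp only: ennreal_of_nat_eq_real_of_nat sum_constant card_lessThan)
      (simp flip: ennreal_plus ennreal_mult)
  finally show ?thesis unfolding a_def .
qed

section \<open>Integration over the forward pass and choice of the constant\<close>

theorem proposition2:
  fixes cm :: cost_model
  assumes "admissible_cost_model cm"
  shows "\<exists>K>0. \<forall>(N::nat) (T::nat) (\<nu> :: 'a::polish_space measure) (m :: 'a \<Rightarrow> 'a \<Rightarrow> real)
            (\<sigma>\<^sub>m::real) (\<sigma>\<^sub>p::real) (P :: 'w measure)
            (\<xi> :: nat \<Rightarrow> nat \<Rightarrow> 'w \<Rightarrow> 'a) (w :: nat \<Rightarrow> nat \<Rightarrow> 'w \<Rightarrow> real).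
          N \<ge> 1 \<longrightarrow> T \<ge> 1 \<longrightarrow>
          transition_density \<nu> m \<longrightarrow>
          0 < \<sigma>\<^sub>m \<longrightarrow> (\<forall>x x'. \<sigma>\<^sub>m \<le> m x x' \<and> m x x' \<le> \<sigma>\<^sub>p) \<longrightarrow>
          particle_system N T P \<xi> w \<longrightarrow>
          expected_ffbsi_cost cm m \<sigma>\<^sub>p N T P \<xi> w
            \<le> ennreal (K * real N * real T * (\<sigma>\<^sub>p / \<sigma>\<^sub>m))"
proof -
  obtain c\<^sub>1 c\<^sub>2 where c1: "\<And>N. N \<ge> 1 \<Longrightarrow> real (cumsum_ops cm N) \<le> c\<^sub>1 * real N"
    and c2: "\<And>N n. 1 \<le> n \<Longrightarrow> n \<le> N \<Longrightarrow>
        real (multinomial_ops cm N n) \<le> c\<^sub>2 * (real n * (1 + ln (1 + real N / real n)))"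
    using assms unfolding admissible_cost_model_def by blast
  define c where "c = max c\<^sub>2 0"
  have c: "0 \<le> c" by (simp add: c_def)
  have mult: "real (multinomial_ops cm N n) \<le> c * (real n * (1 + ln (1 + real N / real n)))"
    if "1 \<le> n" "n \<le> N" for N n
    by (rule order_trans[OF c2[OF that]]) (auto simp: c_def intro!: mult_right_mono)
  have c1_nonneg: "0 \<le> c\<^sub>1" using c1[of 1] by simp
  let ?e = "real (entry_ops cm)" and ?t = "real (test_ops cm)"
  define a where "a = ?t + c + real (candidate_ops cm)"
  have a: "0 \<le> a" using c by (simp add: a_def)
  \<comment> \<open>The first group pays for the final time \<open>T\<close>, the second for each of
    the \<open>T\<close> backward steps; the added 1 makes \<open>K\<close> strictly
    positive.\<close>
  define K where "K = (c\<^sub>1 + 2 * c + ?e) + (c\<^sub>1 + ?e + ?t + 8 * a) + 1"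
  have "0 < K" using c c1_nonneg a by (simp add: K_def)
  moreover have "expected_ffbsi_cost cm m \<sigma>\<^sub>p N T P \<xi> w \<le> ennreal (K * real N * real T * (\<sigma>\<^sub>p / \<sigma>\<^sub>m))"
    if N: "N \<ge> 1" and T: "T \<ge> 1" and \<sigma>\<^sub>m: "0 < \<sigma>\<^sub>m"
      and m: "\<forall>x x'. \<sigma>\<^sub>m \<le> m x x' \<and> m x x' \<le> \<sigma>\<^sub>p" and ps: "particle_system N T P \<xi> w"
    for N T m \<sigma>\<^sub>m \<sigma>\<^sub>p and P :: "'w measure" and \<xi> :: "nat \<Rightarrow> nat \<Rightarrow> 'w \<Rightarrow> 'a" and w
  proof -
    interpret P: prob_space P using ps by (simp add: particle_system_def)
    have \<sigma>: "\<sigma>\<^sub>m \<le> \<sigma>\<^sub>p" using m order_trans by blast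
    define S where "S = \<sigma>\<^sub>p / \<sigma>\<^sub>m"
    have S: "1 \<le> S" using \<sigma> \<sigma>\<^sub>m by (simp add: S_def)
    let ?bound = "real (cumsum_ops cm N + multinomial_ops cm N N + N * entry_ops cm) +
      real T * (real (cumsum_ops cm N + N * entry_ops cm + test_ops cm) + 8 * a * real N * S)"
    \<comment> \<open>Finitely many times are involved, so the exceptional null sets can be merged
      into one.\<close>
    have pos: "AE z in P. \<forall>t\<in>{..T}. 0 < (\<Sum>i<N. w t i z)"
      using ps by (intro AE_ball_countable') (auto simp: particle_system_def)
    have "expected_ffbsi_cost cm m \<sigma>\<^sub>p N T P \<xi> w \<le> (\<integral>\<^sup>+z. ennreal ?bound \<partial>P)"
      unfolding expected_ffbsi_cost_def
    proof (rule nn_integral_mono_AE, use pos AE_space in eventually_elim)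
      case (elim z)
      show ?case
        unfolding a_def S_def
        by (rule nn_integral_ffbsi_cost_le)
          (use elim ps \<sigma>\<^sub>m m \<sigma> c mult in \<open>auto simp: particle_system_def\<close>)
    qed
    also have "\<dots> = ennreal ?bound" by (simp add: P.emeasure_space_1)
    also have "\<dots> \<le> ennreal (K * real N * real T * S)"
    proof (rule ennreal_leI)
      \<comment> \<open>Lets the cost of order \<open>N\<close> at the final time be absorbed into
        \<open>N * T * S\<close>.\<close>
      have TS: "1 \<le> real T * S" using S T mult_mono[of 1 "real T" 1 S] by simp
      \<comment> \<open>The initial sample has size \<open>n = N\<close>, where the logarithmic
        factor is \<open>1 + ln 2 \<le> 2\<close>.\<close>
      have "c * (real N * (1 + ln (1 + real N / real N))) \<le> c * (real N * 2)"
        using N c ln_le_minus_one[of 2] by (intro mult_left_mono) auto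
      then have "real (cumsum_ops cm N + multinomial_ops cm N N + N * entry_ops cm) \<le>
          (c\<^sub>1 + 2 * c + ?e) * real N"
        using c1[OF N] mult[OF N order_refl] by (simp add: algebra_simps)
      also have "\<dots> \<le> (c\<^sub>1 + 2 * c + ?e) * real N * (real T * S)"
        using TS c c1_nonneg mult_left_mono[OF TS, of "(c\<^sub>1 + 2 * c + ?e) * real N"] by simp
      finally have A0: "real (cumsum_ops cm N + multinomial_ops cm N N + N * entry_ops cm) \<le>
          (c\<^sub>1 + 2 * c + ?e) * real N * (real T * S)" .
      have "?t \<le> ?t * real N" using N by (simp add: mult_le_cancel_left1)
      then have "real (cumsum_ops cm N + N * entry_ops cm + test_ops cm) \<le> (c\<^sub>1 + ?e + ?t) * real N"
        using c1[OF N] by (simp add: algebra_simps)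
      also have "\<dots> \<le> (c\<^sub>1 + ?e + ?t) * real N * S"
        using c1_nonneg mult_left_mono[OF S, of "(c\<^sub>1 + ?e + ?t) * real N"] by simp
      finally have "real T * (real (cumsum_ops cm N + N * entry_ops cm + test_ops cm) + 8 * a * real N * S) \<le>
          real T * ((c\<^sub>1 + ?e + ?t) * real N * S + 8 * a * real N * S)"
        by (intro mult_left_mono add_right_mono) auto
      with A0 have "?bound \<le> (K - 1) * real N * real T * S"
        by (simp add: K_def algebra_simps)
      also have "\<dots> \<le> K * real N * real T * S"
        using S by (intro mult_right_mono) auto
      finally show "?bound \<le> K * real N * real T * S" .
    qed
    finally show ?thesis by (simp add: S_def)
  qed
  ultimately show ?thesis by blast
qed

end
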